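(* Let $r\in(0,1)$. In the probability space $(\mathbb{N}_0,\mathcal{A},P_r)$ there are uncountably many infinite sequences $(A_k)_{k\ge 1}$ of non-trivial events such that the family $\{A_k\}_{k\ge1}$ is independent.
   Context: $\mathbb{N}_0=\{0,1,2,3,\dots\}$, $\mathcal{A}$ is the collection of all subsets of $\mathbb{N}_0$, and for $r\in(0,1)$ the probability measure $P_r$ on $\mathcal{A}$ is $P_r(E)=\frac{1-r}{r}\sum_{k\in E\setminus\{0\}}r^k$ (so the point $0$ has probability $0$). Events $A_1,\dots,A_n$ are (mutually) independent if for every $2\le k\le n$ and every choice of $k$ of them, $A_{i_1},\dots,A_{i_k}$ (distinct indices), $P_r(\bigcap_{j=1}^kA_{i_j})=\prod_{j=1}^kP_r(A_{i_j})$. An infinite family of events is independent if each finite collection of its members is independent. An event is trivial if its probability is $0$ or $1$, and non-trivial otherwise. *)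

theory Defs
  imports "HOL-Probability.Probability"
begin

text \<open>The set function $P_r$, as an unconditional sum over the possibly infinite
  set $E \setminus \{0\}$.\<close>

definition geom_prob :: "real \<Rightarrow> nat set \<Rightarrow> real" where
  "geom_prob r E = (1 - r) / r * (\<Sum>\<^sub>\<infinity>k\<in>E - {0}. r ^ k)"

definition geom_space :: "real \<Rightarrow> nat measure" where
  "geom_space r = measure_of UNIV UNIV (\<lambda>E. ennreal (geom_prob r E))"

text \<open>\<^term>\<open>measure_of\<close> silently yields the zero measure unless its set function is countably
  additive; the following lemmas show that for \<open>0 < r < 1\<close> this does not happen.\<close>

lemma space_geom_space [simp]: "space (geom_space r) = UNIV"
  by (simp add: geom_space_def space_measure_of_conv)

lemma sets_geom_space [simp]: "sets (geom_space r) = UNIV"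
proof -
  have "sigma_sets UNIV UNIV = (UNIV :: nat set set)"
    by (auto intro: sigma_sets.Basic)
  then show ?thesis
    by (simp add: geom_space_def sets_measure_of_conv)
qed

lemma geom_prob_eq_pmf:
  assumes "0 < r" "r < 1"
  shows "geom_prob r E = measure (measure_pmf (map_pmf Suc (geometric_pmf (1 - r)))) E"
proof -
  let ?p = "map_pmf Suc (geometric_pmf (1 - r))"
  have p0: "pmf ?p 0 = 0"
    by (auto simp: pmf_eq_0_set_pmf)
  have pS: "pmf ?p k = (1 - r) / r * r ^ k" if "k \<noteq> 0" for k
  proof -
    from that obtain m where k: "k = Suc m" using not0_implies_Suc by blast
    have "pmf ?p k = pmf (geometric_pmf (1 - r)) m"
      unfolding k by (rule pmf_map_inj') simp
    then show ?thesis using assms by (simp add: k)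
  qed
  have "measure ?p E = (\<Sum>\<^sub>\<infinity>k\<in>E. pmf ?p k)"
    by (simp add: measure_pmf_conv_infsetsum infsetsum_infsum pmf_abs_summable)
  also have "\<dots> = (\<Sum>\<^sub>\<infinity>k\<in>E - {0}. (1 - r) / r * r ^ k)"
    by (rule infsum_cong_neutral) (use p0 pS in auto)
  also have "\<dots> = geom_prob r E"
    by (simp only: geom_prob_def infsum_cmult_right')
  finally show ?thesis by simp
qed

lemma geom_space_eq_pmf:
  assumes "0 < r" "r < 1"
  shows "geom_space r = measure_pmf (map_pmf Suc (geometric_pmf (1 - r)))"
proof -
  let ?M = "measure_pmf (map_pmf Suc (geometric_pmf (1 - r)))"
  have "emeasure ?M = (\<lambda>E. ennreal (measure ?M E))"
    by (rule ext) (rule measure_pmf.emeasure_eq_measure)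
  then have "geom_space r = measure_of (space ?M) (sets ?M) (emeasure ?M)"
    by (simp only: geom_space_def geom_prob_eq_pmf[OF assms] space_measure_pmf sets_measure_pmf)
  then show ?thesis by (simp only: measure_of_of_measure)
qed

lemma prob_space_geom_space:
  assumes "0 < r" "r < 1"
  shows "prob_space (geom_space r)"
  using geom_space_eq_pmf[OF assms] by (simp add: measure_pmf.prob_space_axioms)

lemma measure_geom_space:
  assumes "0 < r" "r < 1"
  shows "measure (geom_space r) E = geom_prob r E"
  by (simp only: geom_space_eq_pmf[OF assms] geom_prob_eq_pmf[OF assms])

definition nontrivial_event :: "'a measure \<Rightarrow> 'a set \<Rightarrow> bool" where
  "nontrivial_event M E \<longleftrightarrow> E \<in> sets M \<and> measure M E \<noteq> 0 \<and> measure M E \<noteq> 1"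

end

theory Submission
  imports Defs
begin

text \<open>If \<open>X\<close> has law $P_r$, then the binary digits of \<open>X - 1\<close> are independent, because
  $r^n$ is the product of $r^{2^j}$ over the positions \<open>j\<close> of the digits 1 of \<open>n\<close>.
  The \<open>k\<close>th event prescribes the digit at position \<open>k\<close>. Each choice of prescribed values
  gives a different sequence, so there are as many sequences as subsets of the naturals.\<close>

text \<open>Peels off the lowest binary digit: split by parity, the law gives two copies of the
  geometric law whose ratio is the square of \<open>r\<close>, with total masses in proportion 1 :
  \<open>r\<close>.\<close>

lemma measure_geometric_pmf_parity:
  fixes r :: real
  assumes "0 < r" "r < 1"
  shows "measure (geometric_pmf (1 - r)) E =
    (measure (geometric_pmf (1 - r\<^sup>2)) {m. 2 * m \<in> E} +
     r * measure (geometric_pmf (1 - r\<^sup>2)) {m. 2 * m + 1 \<in> E}) / (1 + r)"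
proof -
  have conv: "measure (geometric_pmf (1 - s)) F = (\<Sum>\<^sub>\<infinity>n\<in>F. s ^ n * (1 - s))"
    if "0 < s" "s < 1" for s :: real and F
  proof -
    have "measure (geometric_pmf (1 - s)) F = (\<Sum>\<^sub>\<infinity>n\<in>F. pmf (geometric_pmf (1 - s)) n)"
      by (simp only: measure_pmf_conv_infsetsum infsetsum_infsum pmf_abs_summable)
    then show ?thesis using that by simp
  qed
  have summable: "(\<lambda>n. r ^ n * (1 - r)) summable_on F" for F
  proof -
    have "(\<lambda>n. pmf (geometric_pmf (1 - r)) n) summable_on F"
      by (rule abs_summable_summable, subst abs_summable_equivalent) (rule pmf_abs_summable)
    then show ?thesis using assms by simp
  qed
  have r2: "0 < r\<^sup>2" "r\<^sup>2 < 1" using assms by (auto simp: power_less_one_iff)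
  let ?E0 = "{m. 2 * m \<in> E}" and ?E1 = "{m. 2 * m + 1 \<in> E}"
  have E: "E = (\<lambda>m. 2 * m) ` ?E0 \<union> (\<lambda>m. 2 * m + 1) ` ?E1"
  proof (intro equalityI subsetI)
    fix n assume "n \<in> E"
    then show "n \<in> (\<lambda>m. 2 * m) ` ?E0 \<union> (\<lambda>m. 2 * m + 1) ` ?E1"
      by (cases "even n") (auto elim!: evenE oddE)
  qed auto
  have "measure (geometric_pmf (1 - r)) E = (\<Sum>\<^sub>\<infinity>n\<in>E. r ^ n * (1 - r))"
    using assms by (rule conv)
  also have "\<dots> = (\<Sum>\<^sub>\<infinity>n\<in>(\<lambda>m. 2 * m) ` ?E0. r ^ n * (1 - r)) +
      (\<Sum>\<^sub>\<infinity>n\<in>(\<lambda>m. 2 * m + 1) ` ?E1. r ^ n * (1 - r))"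
  proof (subst E, rule infsum_Un_disjoint)
    have "2 * m \<noteq> 2 * m' + 1" for m m' :: nat by presburger
    then show "(\<lambda>m. 2 * m) ` ?E0 \<inter> (\<lambda>m. 2 * m + 1) ` ?E1 = {}" by blast
  qed (rule summable)+
  also have "\<dots> = (\<Sum>\<^sub>\<infinity>m\<in>?E0. r ^ (2 * m) * (1 - r)) + (\<Sum>\<^sub>\<infinity>m\<in>?E1. r ^ (2 * m + 1) * (1 - r))"
    by (simp add: infsum_reindex inj_on_def o_def)
  \<comment> \<open>The factor 1 - r equals (1 - r^2) / (1 + r), which supplies the normalisation of
    the law with ratio r^2.\<close>
  also have "(\<Sum>\<^sub>\<infinity>m\<in>?E0. r ^ (2 * m) * (1 - r)) =
      measure (geometric_pmf (1 - r\<^sup>2)) ?E0 / (1 + r)"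
    unfolding conv[OF r2] divide_inverse infsum_cmult_left'[symmetric]
    using assms by (intro infsum_cong) (simp add: power_mult power2_eq_square field_simps)
  also have "(\<Sum>\<^sub>\<infinity>m\<in>?E1. r ^ (2 * m + 1) * (1 - r)) =
      r * measure (geometric_pmf (1 - r\<^sup>2)) ?E1 / (1 + r)"
    unfolding conv[OF r2] divide_inverse infsum_cmult_left'[symmetric] infsum_cmult_right'[symmetric]
    using assms by (intro infsum_cong) (simp add: power_mult power2_eq_square field_simps)
  finally show ?thesis by (simp add: add_divide_distrib)
qed

text \<open>The probability that a digit with odds 1 : \<open>s\<close> for 0 against 1 lies in
  \<open>C\<close>. Allowing a set of values lets \<open>UNIV\<close> stand for an unconstrained
  digit.\<close>

definition digit_weight :: "real \<Rightarrow> bool set \<Rightarrow> real" where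
  "digit_weight s C = (of_bool (False \<in> C) + s * of_bool (True \<in> C)) / (1 + s)"

text \<open>Once digit 0 is split off, the remaining digits are those of \<open>m\<close> under the
  ratio r^2, so the induction must vary \<open>r\<close> and shift \<open>C\<close>. Repeated
  squaring produces the exponents 2^j.\<close>

lemma measure_geometric_pmf_digits:
  fixes r :: real
  assumes "0 < r" "r < 1"
  shows "measure (geometric_pmf (1 - r)) {n. \<forall>j<N. bit n j \<in> C j} =
    (\<Prod>j<N. digit_weight (r ^ 2 ^ j) (C j))"
  using assms
proof (induction N arbitrary: r C)
  case 0
  then show ?case by simp
next
  case (Suc N)
  let ?p = "geometric_pmf (1 - r\<^sup>2)" and ?D = "{n::nat. \<forall>j<N. bit n j \<in> C (Suc j)}"
  have "{m::nat. \<forall>j<Suc N. bit (2 * m) j \<in> C j} = (if False \<in> C 0 then ?D else {})"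
    "{m::nat. \<forall>j<Suc N. bit (2 * m + 1) j \<in> C j} = (if True \<in> C 0 then ?D else {})"
    by (auto simp: All_less_Suc2 bit_0 bit_Suc)
  then have "measure (geometric_pmf (1 - r)) {n. \<forall>j<Suc N. bit n j \<in> C j} =
      digit_weight r (C 0) * measure ?p ?D"
    by (simp only: measure_geometric_pmf_parity[OF Suc.prems] mem_Collect_eq)
      (auto simp: digit_weight_def field_simps)
  also have "measure ?p ?D = (\<Prod>j<N. digit_weight ((r\<^sup>2) ^ 2 ^ j) (C (Suc j)))"
    using Suc.prems by (intro Suc.IH) (auto simp: power_less_one_iff)
  finally show ?case
    by (simp only: prod.lessThan_Suc_shift) (simp add: power_mult)
qed

text \<open>At the outcome 0 the truncated subtraction gives 0 again; this is harmless, since that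
  outcome has probability 0.\<close>

definition digit_event :: "nat set \<Rightarrow> nat \<Rightarrow> nat set" where
  "digit_event S k = {n. bit (n - 1) k \<longleftrightarrow> k \<in> S}"

text \<open>Singletons \<open>J\<close> give the marginals, so this one formula yields both
  non-triviality and independence.\<close>

lemma measure_INT_digit_event:
  assumes "0 < r" "r < 1" "finite J"
  shows "measure (geom_space r) (\<Inter>k\<in>J. digit_event S k) =
    (\<Prod>k\<in>J. digit_weight (r ^ 2 ^ k) {k \<in> S})"
proof -
  from \<open>finite J\<close> obtain N where N: "J \<subseteq> {..<N}"
    by (meson finite_nat_iff_bounded)
  \<comment> \<open>Positions outside \<open>J\<close> are left free, which extends \<open>J\<close>
    to an initial segment at the cost of factors equal to 1.\<close>
  define C where "C j = (if j \<in> J then {j \<in> S} else UNIV)" for j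
  have "Suc -` (\<Inter>k\<in>J. digit_event S k) = {n. \<forall>j<N. bit n j \<in> C j}"
    using N by (fastforce simp: digit_event_def C_def split: if_splits)
  then have "measure (geom_space r) (\<Inter>k\<in>J. digit_event S k) =
      (\<Prod>j<N. digit_weight (r ^ 2 ^ j) (C j))"
    using assms by (simp add: geom_space_eq_pmf measure_map_pmf measure_geometric_pmf_digits)
  also have "\<dots> = (\<Prod>k\<in>J. digit_weight (r ^ 2 ^ k) {k \<in> S})"
  proof (rule prod.mono_neutral_cong_right)
    have "1 + r ^ 2 ^ j \<noteq> 0" for j :: nat
      using zero_less_power[OF \<open>0 < r\<close>, of "2 ^ j"] by linarith
    then show "\<forall>j\<in>{..<N} - J. digit_weight (r ^ 2 ^ j) (C j) = 1"
      by (simp add: C_def digit_weight_def)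
  qed (use N in \<open>auto simp: C_def\<close>)
  finally show ?thesis .
qed

text \<open>With s = r^(2^k) > 0 the probability is 1/(1+s) or s/(1+s).\<close>

lemma nontrivial_digit_event:
  assumes "0 < r" "r < 1"
  shows "nontrivial_event (geom_space r) (digit_event S k)"
proof -
  have "1 + r ^ 2 ^ k \<noteq> 0"
    using zero_less_power[OF \<open>0 < r\<close>, of "2 ^ k"] by linarith
  moreover have "measure (geom_space r) (digit_event S k) = digit_weight (r ^ 2 ^ k) {k \<in> S}"
    using measure_INT_digit_event[OF assms, of "{k}" S] by simp
  ultimately show ?thesis
    by (cases "k \<in> S") (use assms in \<open>simp_all add: nontrivial_event_def digit_weight_def\<close>)
qed

lemma indep_digit_events:
  assumes "0 < r" "r < 1"
  shows "prob_space.indep_events (geom_space r) (digit_event S) I"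
proof -
  interpret prob_space "geom_space r" using assms by (rule prob_space_geom_space)
  have "measure (geom_space r) (digit_event S k) = digit_weight (r ^ 2 ^ k) {k \<in> S}" for k
    using measure_INT_digit_event[OF assms, of "{k}" S] by simp
  then show ?thesis
    using assms by (simp add: indep_events_def measure_INT_digit_event)
qed

text \<open>Taking images under an injection from the naturals into \<open>A\<close> reduces this to
  Cantor's theorem.\<close>

lemma uncountable_Pow:
  assumes "infinite A"
  shows "uncountable (Pow A)"
proof
  assume "countable (Pow A)"
  obtain f :: "nat \<Rightarrow> _" where f: "inj f" "range f \<subseteq> A"
    using assms infinite_countable_subset by blast
  have "inj_on (image f) UNIV"
    using f(1) by (simp add: inj_on_def inj_image_eq_iff)
  moreover have "range (image f) \<subseteq> Pow A" using f(2) by auto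
  ultimately have "countable (UNIV :: nat set set)"
    using \<open>countable (Pow A)\<close> countable_image_inj_on countable_subset by blast
  then have "range (from_nat_into UNIV) = Pow (UNIV :: nat set)"
    by (simp add: range_from_nat_into)
  then show False using Cantors_theorem by blast
qed

theorem mainTheorem1:
  fixes r :: real
  assumes "r \<in> {0<..<1}"
  shows "uncountable {A \<in> {1::nat..} \<rightarrow>\<^sub>E {E. nontrivial_event (geom_space r) E}.
    prob_space.indep_events (geom_space r) A {1..}}"
    (is "uncountable ?X")
proof
  assume "countable ?X"
  have r: "0 < r" "r < 1" using assms by auto
  interpret prob_space "geom_space r" using r by (rule prob_space_geom_space)
  \<comment> \<open>Restriction makes the sequence \<open>undefined\<close> at index 0, as the
    extensional function space requires.\<close>
  let ?f = "\<lambda>S. restrict (digit_event S) {1::nat..}"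
  have "?f S \<in> ?X" for S
  proof -
    have "indep_events (?f S) {1..} \<longleftrightarrow> indep_events (digit_event S) {1..}"
      unfolding indep_events_def_alt by (intro indep_sets_cong) auto
    then show ?thesis
      using r by (auto simp: nontrivial_digit_event indep_digit_events)
  qed
  \<comment> \<open>Index 0 is cut off, so membership of 0 in \<open>S\<close> is invisible to
    \<open>?f\<close>; hence only subsets of {1..} are compared.\<close>
  moreover have "inj_on ?f (Pow {1..})"
  proof
    fix S T :: "nat set"
    assume "S \<in> Pow {1..}" "T \<in> Pow {1..}" "?f S = ?f T"
    have "k \<in> S \<longleftrightarrow> k \<in> T" if "1 \<le> k" for k
    proof -
      have "digit_event S k = digit_event T k"
        using fun_cong[OF \<open>?f S = ?f T\<close>, of k] that by simp
      \<comment> \<open>the outcome 1 corresponds to the number 0, all of whose digits are 0\<close>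
      then have "1 \<in> digit_event S k \<longleftrightarrow> 1 \<in> digit_event T k" by simp
      then show ?thesis by (simp add: digit_event_def)
    qed
    with \<open>S \<in> _\<close> \<open>T \<in> _\<close> show "S = T" by (auto 0 3)
  qed
  ultimately have "countable (Pow {1::nat..})"
    using \<open>countable ?X\<close> by (meson countable_image_inj_on countable_subset image_subsetI)
  then show False using uncountable_Pow infinite_Ici by blast
qed

end
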